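(* Let $a\in L^1(I)$ and $\lambda\in\mathbb{R}$. If the operator $L[\lambda]$ is nonresonant in $X_D$ and in $X_N$, then for all $(t,s)\in I\times I$ $$G_N[\lambda](t,s)=G_D[\lambda](t,s)+r_1[\lambda](t)\,G_N[\lambda](0,s)+r_2[\lambda](t)\,G_N[\lambda](1,s)$$ $$=G_D[\lambda](t,s)-\frac{\partial}{\partial s}G_D[\lambda](t,0)\,G_N[\lambda](0,s)+\frac{\partial}{\partial s}G_D[\lambda](t,1)\,G_N[\lambda](1,s).$$
   Context: $I=[0,1]$, $a\in L^1(I)$ is real-valued, $\lambda\in\mathbb{R}$, and $L[\lambda]u(t)=u''(t)+(a(t)+\lambda)u(t)$. $W^{2,1}(I)=\{u\in C(I):u'\in AC(I)\}$, where $AC(I)$ is the set of absolutely continuous functions on $I$. $X_D=\{u\in W^{2,1}(I):u(0)=u(1)=0\}$ (Dirichlet) and $X_N=\{u\in W^{2,1}(I):u'(0)=u'(1)=0\}$ (Neumann). $L[\lambda]$ is nonresonant in $X$ if $u=0$ is the only $u\in X$ with $L[\lambda]u=0$ a.e. on $I$. In that case, for every $\sigma\in L^1(I)$ the problem $L[\lambda]u=\sigma$ a.e. on $I$, $u\in X$, has a unique solution, given by $u(t)=\int_0^1G(t,s)\sigma(s)\,ds$, where the continuous function $G:I\times I\to\mathbb{R}$ is the Green's function; it is denoted $G_D[\lambda]$ for $X=X_D$ and $G_N[\lambda]$ for $X=X_N$. $r_1[\lambda]$ is the unique solution of $L[\lambda]u=0$ a.e. on $I$, $u(0)=1$, $u(1)=0$;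 $r_2[\lambda]$ is the unique solution of $L[\lambda]u=0$ a.e. on $I$, $u(0)=0$, $u(1)=1$. Convention: $\frac{\partial}{\partial s}G(t,0)$ and $\frac{\partial}{\partial s}G(t,1)$ are (one-sided) derivatives for $t\in(0,1)$, extended by continuity to $t\in\{0,1\}$. *)

theory Defs
  imports "HOL-Analysis.Analysis"
begin

abbreviation I01 :: "real set" where
  "I01 \<equiv> {0..1}"

definition L1 :: "(real \<Rightarrow> real) set" where
  "L1 = {f. integrable (lebesgue_on I01) f}"

text \<open>The usual epsilon-delta definition. A division is a finite family of nonempty compact
  intervals with pairwise disjoint interiors, so \<open>Inf K\<close> and \<open>Sup K\<close> are the
  endpoints of the member \<open>K\<close>.\<close>

definition AC :: "(real \<Rightarrow> real) set" where
  "AC = {f. \<forall>\<epsilon>>0. \<exists>\<delta>>0. \<forall>\<D> S.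
     \<D> division_of S \<and> S \<subseteq> I01 \<and> (\<Sum>K\<in>\<D>. Sup K - Inf K) < \<delta>
       \<longrightarrow> (\<Sum>K\<in>\<D>. \<bar>f (Sup K) - f (Inf K)\<bar>) < \<epsilon>}"

text \<open>Functions on the unit interval are total functions on the reals of which only the values
  on \<open>I01\<close> matter; the derivative is taken within \<open>I01\<close>, hence is one-sided at
  0 and 1.\<close>

definition D :: "(real \<Rightarrow> real) \<Rightarrow> real \<Rightarrow> real" where
  "D u t = vector_derivative u (at t within I01)"

definition W21 :: "(real \<Rightarrow> real) set" where
  "W21 = {u. continuous_on I01 u \<and> u differentiable_on I01 \<and> D u \<in> AC}"

definition X_D :: "(real \<Rightarrow> real) set" where
  "X_D = {u \<in> W21. u 0 = 0 \<and> u 1 = 0}"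

definition X_N :: "(real \<Rightarrow> real) set" where
  "X_N = {u \<in> W21. D u 0 = 0 \<and> D u 1 = 0}"

definition L :: "(real \<Rightarrow> real) \<Rightarrow> real \<Rightarrow> (real \<Rightarrow> real) \<Rightarrow> real \<Rightarrow> real" where
  "L a lam u t = D (D u) t + (a t + lam) * u t"

text \<open>The equation \<open>L[lam]u = \<sigma>\<close> almost everywhere on the unit interval. As
  \<open>D (D u) t\<close> is an arbitrary number where \<open>D u\<close> is not differentiable, the
  existence of the second derivative is required explicitly (for \<open>u\<close> in \<open>W21\<close>
  it exists at almost every point anyway).\<close>

definition solves :: "(real \<Rightarrow> real) \<Rightarrow> real \<Rightarrow> (real \<Rightarrow> real) \<Rightarrow> (real \<Rightarrow> real) \<Rightarrow> bool" where
  "solves a lam \<sigma> u \<longleftrightarrow>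
     (AE t in lebesgue_on I01. D u differentiable (at t within I01) \<and> L a lam u t = \<sigma> t)"

definition nonresonant :: "(real \<Rightarrow> real) \<Rightarrow> real \<Rightarrow> (real \<Rightarrow> real) set \<Rightarrow> bool" where
  "nonresonant a lam X \<longleftrightarrow>
     (\<forall>u\<in>X. solves a lam (\<lambda>_. 0) u \<longrightarrow> (\<forall>t\<in>I01. u t = 0))"

text \<open>Uniqueness of the solution represented by \<open>G\<close> is the content of nonresonance and
  is therefore not repeated here.\<close>

definition is_green ::
    "(real \<Rightarrow> real) \<Rightarrow> real \<Rightarrow> (real \<Rightarrow> real) set \<Rightarrow> (real \<Rightarrow> real \<Rightarrow> real) \<Rightarrow> bool" where
  "is_green a lam X G \<longleftrightarrow>
     continuous_on (I01 \<times> I01) (\<lambda>(t, s). G t s) \<and>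
     (\<forall>\<sigma>\<in>L1. (\<lambda>t. LINT s|lebesgue_on I01. G t s * \<sigma> s) \<in> X \<and>
        solves a lam \<sigma> (\<lambda>t. LINT s|lebesgue_on I01. G t s * \<sigma> s))"

definition is_r1 :: "(real \<Rightarrow> real) \<Rightarrow> real \<Rightarrow> (real \<Rightarrow> real) \<Rightarrow> bool" where
  "is_r1 a lam r \<longleftrightarrow> r \<in> W21 \<and> solves a lam (\<lambda>_. 0) r \<and> r 0 = 1 \<and> r 1 = 0"

definition is_r2 :: "(real \<Rightarrow> real) \<Rightarrow> real \<Rightarrow> (real \<Rightarrow> real) \<Rightarrow> bool" where
  "is_r2 a lam r \<longleftrightarrow> r \<in> W21 \<and> solves a lam (\<lambda>_. 0) r \<and> r 0 = 0 \<and> r 1 = 1"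

text \<open>The partial derivative of \<open>G\<close> in its second argument at \<open>(t, c)\<close>, for
  \<open>c\<close> equal to 0 or 1: the one-sided derivative for \<open>t\<close> strictly between 0 and 1,
  extended by continuity to the endpoints. The extension matters: for the Dirichlet problem
  \<open>G 0 s = 0\<close> for all \<open>s\<close>, so the derivative of \<open>G 0\<close> at 0 is 0,
  whereas the limit as \<open>t\<close> tends to 0 is -1.\<close>

definition edge_ds :: "(real \<Rightarrow> real \<Rightarrow> real) \<Rightarrow> real \<Rightarrow> real \<Rightarrow> real" where
  "edge_ds G t c =
     (if t \<in> {0<..<1} then D (G t) c
      else Lim (at t within {0<..<1}) (\<lambda>\<tau>. D (G \<tau>) c))"

definition edge_ds_exists :: "(real \<Rightarrow> real \<Rightarrow> real) \<Rightarrow> real \<Rightarrow> bool" where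
  "edge_ds_exists G c \<longleftrightarrow>
     (\<forall>t\<in>{0<..<1}. G t differentiable (at c within I01)) \<and>
     (\<forall>t\<in>{0, 1}. \<exists>l. ((\<lambda>\<tau>. D (G \<tau>) c) \<longlongrightarrow> l) (at t within {0<..<1}))"

end

theory Submission
  imports Defs
begin

text \<open>
  Fix a right-hand side \<open>\<sigma>\<close> and let \<open>u\<close> and \<open>v\<close> be the Neumann and the Dirichlet solution of
  \<open>L[lam] x = \<sigma>\<close>. Then \<open>u - v\<close> solves the homogeneous equation, and so does
  \<open>u(0) r\<^sub>1 + u(1) r\<^sub>2\<close>; both have the boundary values \<open>u(0)\<close> and \<open>u(1)\<close>, so Dirichlet nonresonance
  makes them equal. Writing \<open>u\<close> and \<open>v\<close> as integrals against the Green's functions, this is the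
  first identity integrated against \<open>\<sigma>\<close>. For fixed \<open>t\<close> the two sides are continuous in \<open>s\<close>, so
  taking their difference for \<open>\<sigma>\<close> gives a square with integral zero, and the identity holds
  pointwise (\<open>green_Neumann_minus_Dirichlet\<close>).

  The second identity amounts to \<open>\<partial>G\<^sub>D/\<partial>s (t, 0) = - r\<^sub>1 t\<close> and \<open>\<partial>G\<^sub>D/\<partial>s (t, 1) = r\<^sub>2 t\<close>. Let \<open>w\<close> be
  the constant Wronskian \<open>r\<^sub>1 r\<^sub>2' - r\<^sub>1' r\<^sub>2\<close>. The same testing argument, now with Lagrange's identity,
  shows \<open>w G\<^sub>D(t, s) = - r\<^sub>1(max t s) r\<^sub>2(min t s)\<close> (\<open>Dirichlet_green_kernel\<close>). Since
  \<open>w = r\<^sub>2'(0) = - r\<^sub>1'(1)\<close>, differentiation at \<open>s = 0\<close> and \<open>s = 1\<close> gives the claim once \<open>w \<noteq> 0\<close> is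
  known, which is uniqueness for the initial value problem (\<open>homogeneous_initial_value_unique\<close>).

  Lagrange's identity and the uniqueness argument integrate derivatives that exist only almost
  everywhere, as the coefficient is merely integrable. They rest on the fundamental theorem of calculus
  for absolutely continuous functions (\<open>AC_has_integral\<close>).
\<close>

section \<open>The one-sided derivative on the unit interval\<close>

lemma D_eqI:
  assumes "(u has_vector_derivative d) (at t within I01)" and "t \<in> I01"
  shows "D u t = d"
  unfolding D_def using vector_derivative_within_closed_interval[of 0 1 t u d] assms by simp

lemma D_has_derivative:
  assumes "u differentiable (at t within I01)"
  shows "(u has_vector_derivative D u t) (at t within I01)"
  unfolding D_def using assms vector_derivative_works by blast

lemma W21_has_derivative:
  assumes "u \<in> W21" and "t \<in> I01"
  shows "(u has_vector_derivative D u t) (at t within I01)"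
  using assms by (intro D_has_derivative) (auto simp: W21_def differentiable_on_def)

section \<open>Absolutely continuous functions\<close>

lemma division_I01_member:
  assumes "\<D> division_of S" and "S \<subseteq> I01" and "K \<in> \<D>"
  shows "Inf K \<in> I01" and "Sup K \<in> I01" and "Inf K \<le> Sup K" and "K = {Inf K..Sup K}"
proof -
  obtain u v where K: "K = {u..v}" and "K \<noteq> {}"
    using assms division_ofD(3,4)[OF assms(1,3)] by auto
  moreover have "K \<subseteq> I01"
    using assms division_ofD(2)[OF assms(1,3)] by auto
  ultimately show "Inf K \<in> I01" "Sup K \<in> I01" "Inf K \<le> Sup K" "K = {Inf K..Sup K}"
    by auto
qed

lemma AC_obtains_delta:
  assumes "f \<in> AC" and "\<epsilon> > 0"
  obtains \<delta> where "\<delta> > 0"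
    and "\<And>\<D> S. \<D> division_of S \<Longrightarrow> S \<subseteq> I01 \<Longrightarrow> (\<Sum>K\<in>\<D>. Sup K - Inf K) < \<delta>
           \<Longrightarrow> (\<Sum>K\<in>\<D>. \<bar>f (Sup K) - f (Inf K)\<bar>) < \<epsilon>"
  using assms unfolding AC_def by blast

text \<open>The closure properties of \<open>AC\<close> below all come from this comparison of increments:
  congruence on \<open>I01\<close>, linear combinations, products, and Lipschitz functions (with both
  \<open>f\<close> and \<open>g\<close> the identity).\<close>

lemma AC_dominated:
  assumes f: "f \<in> AC" and g: "g \<in> AC"
    and h: "\<And>x y. x \<in> I01 \<Longrightarrow> y \<in> I01 \<Longrightarrow> \<bar>h x - h y\<bar> \<le> C * (\<bar>f x - f y\<bar> + \<bar>g x - g y\<bar>)"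
  shows "h \<in> AC"
  unfolding AC_def
proof (intro CollectI allI impI)
  fix \<epsilon> :: real
  assume "\<epsilon> > 0"
  define B where "B = max C 1"
  have "B > 0"
    by (simp add: B_def)
  define e where "e = \<epsilon> / (2 * B)"
  have "e > 0"
    using \<open>\<epsilon> > 0\<close> \<open>B > 0\<close> by (simp add: e_def)
  obtain d1 where d1: "d1 > 0" "\<And>\<D> S. \<D> division_of S \<Longrightarrow> S \<subseteq> I01
      \<Longrightarrow> (\<Sum>K\<in>\<D>. Sup K - Inf K) < d1 \<Longrightarrow> (\<Sum>K\<in>\<D>. \<bar>f (Sup K) - f (Inf K)\<bar>) < e"
    by (rule AC_obtains_delta[OF f \<open>e > 0\<close>]) blast
  obtain d2 where d2: "d2 > 0" "\<And>\<D> S. \<D> division_of S \<Longrightarrow> S \<subseteq> I01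
      \<Longrightarrow> (\<Sum>K\<in>\<D>. Sup K - Inf K) < d2 \<Longrightarrow> (\<Sum>K\<in>\<D>. \<bar>g (Sup K) - g (Inf K)\<bar>) < e"
    by (rule AC_obtains_delta[OF g \<open>e > 0\<close>]) blast
  show "\<exists>\<delta>>0. \<forall>\<D> S. \<D> division_of S \<and> S \<subseteq> I01 \<and> (\<Sum>K\<in>\<D>. Sup K - Inf K) < \<delta>
       \<longrightarrow> (\<Sum>K\<in>\<D>. \<bar>h (Sup K) - h (Inf K)\<bar>) < \<epsilon>"
  proof (intro exI[of _ "min d1 d2"] conjI allI impI)
    show "min d1 d2 > 0"
      using d1 d2 by simp
    fix \<D> and S :: "real set"
    assume *: "\<D> division_of S \<and> S \<subseteq> I01 \<and> (\<Sum>K\<in>\<D>. Sup K - Inf K) < min d1 d2"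
    have "(\<Sum>K\<in>\<D>. \<bar>h (Sup K) - h (Inf K)\<bar>)
        \<le> (\<Sum>K\<in>\<D>. B * (\<bar>f (Sup K) - f (Inf K)\<bar> + \<bar>g (Sup K) - g (Inf K)\<bar>))"
    proof (rule sum_mono)
      fix K assume "K \<in> \<D>"
      then have "\<bar>h (Sup K) - h (Inf K)\<bar> \<le> C * (\<bar>f (Sup K) - f (Inf K)\<bar> + \<bar>g (Sup K) - g (Inf K)\<bar>)"
        using * by (intro h division_I01_member) auto
      also have "\<dots> \<le> B * (\<bar>f (Sup K) - f (Inf K)\<bar> + \<bar>g (Sup K) - g (Inf K)\<bar>)"
        by (intro mult_right_mono) (auto simp: B_def)
      finally show "\<bar>h (Sup K) - h (Inf K)\<bar> \<le> B * (\<bar>f (Sup K) - f (Inf K)\<bar> + \<bar>g (Sup K) - g (Inf K)\<bar>)" .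
    qed
    also have "\<dots> = B * ((\<Sum>K\<in>\<D>. \<bar>f (Sup K) - f (Inf K)\<bar>) + (\<Sum>K\<in>\<D>. \<bar>g (Sup K) - g (Inf K)\<bar>))"
      by (simp add: sum.distrib flip: sum_distrib_left)
    also have "\<dots> < B * (e + e)"
      using d1(2)[of \<D> S] d2(2)[of \<D> S] * \<open>B > 0\<close> by (intro mult_strict_left_mono add_strict_mono) auto
    also have "\<dots> = \<epsilon>"
      using \<open>B > 0\<close> by (simp add: e_def)
    finally show "(\<Sum>K\<in>\<D>. \<bar>h (Sup K) - h (Inf K)\<bar>) < \<epsilon>" .
  qed
qed

lemma AC_ident: "(\<lambda>t. t) \<in> AC"
  unfolding AC_def
proof (intro CollectI allI impI)
  fix \<epsilon> :: real
  assume "\<epsilon> > 0"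
  moreover have "(\<Sum>K\<in>\<D>. \<bar>Sup K - Inf K\<bar>) = (\<Sum>K\<in>\<D>. Sup K - Inf K)"
    if "\<D> division_of S" "S \<subseteq> I01" for \<D> and S :: "real set"
    using division_I01_member(3)[OF that] by (intro sum.cong) auto
  ultimately show "\<exists>\<delta>>0. \<forall>\<D> S. \<D> division_of S \<and> S \<subseteq> I01 \<and> (\<Sum>K\<in>\<D>. Sup K - Inf K) < \<delta>
       \<longrightarrow> (\<Sum>K\<in>\<D>. \<bar>Sup K - Inf K\<bar>) < \<epsilon>"
    by (intro exI[of _ \<epsilon>]) auto
qed

lemma AC_imp_continuous_on:
  assumes "f \<in> AC"
  shows "continuous_on I01 f"
  unfolding continuous_on_iff
proof (intro ballI allI impI)
  fix x \<epsilon> :: real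
  assume x: "x \<in> I01" and "\<epsilon> > 0"
  obtain d where d: "d > 0" "\<And>\<D> S. \<D> division_of S \<Longrightarrow> S \<subseteq> I01
      \<Longrightarrow> (\<Sum>K\<in>\<D>. Sup K - Inf K) < d \<Longrightarrow> (\<Sum>K\<in>\<D>. \<bar>f (Sup K) - f (Inf K)\<bar>) < \<epsilon>"
    by (rule AC_obtains_delta[OF assms \<open>\<epsilon> > 0\<close>]) blast
  have *: "\<bar>f z - f y\<bar> < \<epsilon>" if "y \<in> I01" "z \<in> I01" "y \<le> z" "z - y < d" for y z
    using d(2)[of "{{y..z}}" "{y..z}"] that division_of_self[of y z] by auto
  have "dist (f y) (f x) < \<epsilon>" if "y \<in> I01" "dist y x < d" for y
    using *[of x y] *[of y x] x that by (cases "x \<le> y") (auto simp: dist_real_def)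
  then show "\<exists>d>0. \<forall>x'\<in>I01. dist x' x < d \<longrightarrow> dist (f x') (f x) < \<epsilon>"
    using d(1) by blast
qed

lemma continuous_on_I01_bounded:
  fixes f :: "real \<Rightarrow> real"
  assumes "continuous_on I01 f"
  obtains B where "B > 0" and "\<And>t. t \<in> I01 \<Longrightarrow> \<bar>f t\<bar> \<le> B"
proof -
  have "bounded (f ` I01)"
    using assms by (intro compact_imp_bounded compact_continuous_image) auto
  then show ?thesis
    using that unfolding bounded_pos by auto
qed

text \<open>The identity for \<open>h\<close> is asked on \<open>I01\<close> only because the derivative of a combination of two
  functions is known to be the combination of their derivatives at these points alone.\<close>

lemma AC_linear_combination:
  assumes f: "f \<in> AC" and g: "g \<in> AC" and h: "\<And>t. t \<in> I01 \<Longrightarrow> h t = c * f t + d * g t"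
  shows "h \<in> AC"
proof (rule AC_dominated[OF f g, where C = "\<bar>c\<bar> + \<bar>d\<bar>"])
  fix x y :: real
  assume "x \<in> I01" "y \<in> I01"
  then have "\<bar>h x - h y\<bar> = \<bar>c * (f x - f y) + d * (g x - g y)\<bar>"
    by (simp add: h algebra_simps)
  also have "\<dots> \<le> \<bar>c\<bar> * \<bar>f x - f y\<bar> + \<bar>d\<bar> * \<bar>g x - g y\<bar>"
    by (metis abs_mult abs_triangle_ineq)
  also have "\<dots> \<le> (\<bar>c\<bar> + \<bar>d\<bar>) * (\<bar>f x - f y\<bar> + \<bar>g x - g y\<bar>)"
    by (simp add: algebra_simps)
  finally show "\<bar>h x - h y\<bar> \<le> (\<bar>c\<bar> + \<bar>d\<bar>) * (\<bar>f x - f y\<bar> + \<bar>g x - g y\<bar>)" .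
qed

text \<open>Both factors are bounded on the compact interval, so
  \<open>\<bar>\<Delta>(f g)\<bar> \<le> \<bar>g\<bar> \<bar>\<Delta>f\<bar> + \<bar>f\<bar> \<bar>\<Delta>g\<bar>\<close> bounds the increments of the product.\<close>

lemma AC_mult:
  assumes f: "f \<in> AC" and g: "g \<in> AC"
  shows "(\<lambda>t. f t * g t) \<in> AC"
proof -
  obtain B where B: "B > 0" "\<And>t. t \<in> I01 \<Longrightarrow> \<bar>f t\<bar> \<le> B"
    using continuous_on_I01_bounded[OF AC_imp_continuous_on[OF f]] by blast
  obtain C where C: "C > 0" "\<And>t. t \<in> I01 \<Longrightarrow> \<bar>g t\<bar> \<le> C"
    using continuous_on_I01_bounded[OF AC_imp_continuous_on[OF g]] by blast
  show ?thesis
  proof (rule AC_dominated[OF f g, where C = "B + C"])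
    fix x y :: real
    assume xy: "x \<in> I01" "y \<in> I01"
    have "\<bar>f x * g x - f y * g y\<bar> = \<bar>g x * (f x - f y) + f y * (g x - g y)\<bar>"
      by (simp add: algebra_simps)
    also have "\<dots> \<le> \<bar>g x\<bar> * \<bar>f x - f y\<bar> + \<bar>f y\<bar> * \<bar>g x - g y\<bar>"
      by (metis abs_mult abs_triangle_ineq)
    also have "\<dots> \<le> C * \<bar>f x - f y\<bar> + B * \<bar>g x - g y\<bar>"
      using B C xy by (intro add_mono mult_right_mono) auto
    also have "\<dots> \<le> (B + C) * (\<bar>f x - f y\<bar> + \<bar>g x - g y\<bar>)"
      using B(1) C(1) by (simp add: algebra_simps)
    finally show "\<bar>f x * g x - f y * g y\<bar> \<le> (B + C) * (\<bar>f x - f y\<bar> + \<bar>g x - g y\<bar>)" .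
  qed
qed

text \<open>The derivative of \<open>u\<close> is continuous, hence bounded, and a function with bounded derivative
  is Lipschitz.\<close>

lemma W21_imp_AC:
  assumes u: "u \<in> W21"
  shows "u \<in> AC" and "D u \<in> AC"
proof -
  show "D u \<in> AC"
    using u by (simp add: W21_def)
  obtain B where B: "B > 0" "\<And>t. t \<in> I01 \<Longrightarrow> \<bar>D u t\<bar> \<le> B"
    using continuous_on_I01_bounded[OF AC_imp_continuous_on[OF \<open>D u \<in> AC\<close>]] by blast
  show "u \<in> AC"
  proof (rule AC_dominated[OF AC_ident AC_ident, where C = B])
    fix x y :: real
    assume xy: "x \<in> I01" "y \<in> I01"
    have "norm (u x - u y) \<le> B * norm (x - y)"
    proof (rule field_differentiable_bound[where S = I01 and f' = "D u"])
      show "(u has_field_derivative D u z) (at z within I01)" if "z \<in> I01" for z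
        using W21_has_derivative[OF u that] by (simp add: has_real_derivative_iff_has_vector_derivative)
    qed (use B xy in auto)
    also have "\<dots> \<le> B * (\<bar>x - y\<bar> + \<bar>x - y\<bar>)"
      using B by (intro mult_left_mono) auto
    finally show "\<bar>u x - u y\<bar> \<le> B * (\<bar>x - y\<bar> + \<bar>x - y\<bar>)"
      by simp
  qed
qed

section \<open>The fundamental theorem of calculus\<close>

lemma negligible_obtains_open_superset:
  fixes N :: "real set"
  assumes N: "negligible N" and "\<delta> > 0"
  obtains U where "open U" "N \<subseteq> U" "U \<in> lmeasurable" "measure lebesgue U < \<delta>"
proof -
  obtain U where U: "open U" "N \<subseteq> U" "U - N \<in> lmeasurable" "emeasure lebesgue (U - N) < ennreal \<delta>"
    using sets_lebesgue_outer_open[OF _ \<open>\<delta> > 0\<close>] negligible_imp_sets[OF N] by blast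
  have Nm: "N \<in> lmeasurable" "measure lebesgue N = 0"
    using N negligible_imp_measurable negligible_imp_measure0 by auto
  have eq: "U = (U - N) \<union> N"
    using U(2) by auto
  have "measure lebesgue U \<le> measure lebesgue (U - N) + measure lebesgue N"
    using measure_Un_le[of "U - N" lebesgue N] U(3) Nm(1) eq by auto
  also have "measure lebesgue (U - N) < \<delta>"
    using U(3,4) \<open>\<delta> > 0\<close> by (simp add: emeasure_eq_measure2 ennreal_less_iff)
  finally have "measure lebesgue U < \<delta>"
    using Nm(2) by simp
  moreover have "U \<in> lmeasurable"
    using fmeasurable.Un[OF U(3) Nm(1)] eq by simp
  ultimately show ?thesis
    using that U(1,2) by blast
qed

text \<open>The gauge integral matches the definition of absolute continuity directly, and the
  integrability of \<open>g\<close> comes out as part of the result. At a tag outside \<open>N\<close>, differentiability bounds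
  the error of the tagged interval by a small multiple of its length. The intervals with a tag in \<open>N\<close>
  are confined by the gauge to an open set of measure less than the \<open>\<delta>\<close> of absolute continuity; with the
  integrand set to zero on \<open>N\<close>, their error is a small sum of increments of \<open>f\<close>.\<close>

lemma AC_has_integral:
  assumes f: "f \<in> AC" and N: "negligible N"
    and g: "\<And>t. t \<in> I01 - N \<Longrightarrow> (f has_vector_derivative g t) (at t within I01)"
    and ab: "0 \<le> \<alpha>" "\<alpha> \<le> \<beta>" "\<beta> \<le> 1"
  shows "(g has_integral (f \<beta> - f \<alpha>)) {\<alpha>..\<beta>}"
proof -
  define h where "h t = (if t \<in> N then 0 else g t)" for t
  have sub: "{\<alpha>..\<beta>} \<subseteq> I01"
    using ab by auto
  have "(h has_integral (f \<beta> - f \<alpha>)) (cbox \<alpha> \<beta>)"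
    unfolding has_integral
  proof (intro allI impI)
    fix e :: real
    assume "e > 0"
    obtain \<delta> where \<delta>: "\<delta> > 0" "\<And>\<D> S. \<D> division_of S \<Longrightarrow> S \<subseteq> I01
      \<Longrightarrow> (\<Sum>K\<in>\<D>. Sup K - Inf K) < \<delta> \<Longrightarrow> (\<Sum>K\<in>\<D>. \<bar>f (Sup K) - f (Inf K)\<bar>) < e / 2"
      by (rule AC_obtains_delta[OF f half_gt_zero[OF \<open>e > 0\<close>]]) blast
    obtain U where U: "open U" "N \<subseteq> U" and Um: "U \<in> lmeasurable" "measure lebesgue U < \<delta>"
      using negligible_obtains_open_superset[OF N \<delta>(1)] .
    have "\<exists>d>0. (x \<in> N \<longrightarrow> ball x d \<subseteq> U) \<and>
        (x \<in> I01 - N \<longrightarrow> (\<forall>y\<in>I01. norm (y - x) < d \<longrightarrow> norm (f y - f x - (y - x) *\<^sub>R g x) \<le> e/2 * norm (y - x)))" for x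
    proof (cases "x \<in> I01 - N")
      case True
      then show ?thesis
        using g[OF True] \<open>e > 0\<close> unfolding has_vector_derivative_def has_derivative_within_alt
        by (metis DiffD2 half_gt_zero)
    next
      case False
      then show ?thesis
        using U(1,2) open_contains_ball by (cases "x \<in> N") (blast, auto intro: exI[of _ 1])
    qed
    then obtain d where d: "\<And>x. d x > 0" "\<And>x. x \<in> N \<Longrightarrow> ball x (d x) \<subseteq> U"
        "\<And>x y. x \<in> I01 - N \<Longrightarrow> y \<in> I01 \<Longrightarrow> norm (y - x) < d x
            \<Longrightarrow> norm (f y - f x - (y - x) *\<^sub>R g x) \<le> e/2 * norm (y - x)"
      by metis
    show "\<exists>\<gamma>. gauge \<gamma> \<and> (\<forall>\<D>. \<D> tagged_division_of cbox \<alpha> \<beta> \<and> \<gamma> fine \<D> \<longrightarrow>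
        norm ((\<Sum>(x, k)\<in>\<D>. measure lborel k *\<^sub>R h x) - (f \<beta> - f \<alpha>)) < e)"
    proof (intro exI[of _ "\<lambda>x. ball x (d x)"] conjI allI impI)
      show "gauge (\<lambda>x. ball x (d x))"
        using d(1) gauge_ball_dependent by blast
      fix p
      assume "p tagged_division_of cbox \<alpha> \<beta> \<and> (\<lambda>x. ball x (d x)) fine p"
      then have p: "p tagged_division_of cbox \<alpha> \<beta>" and fine: "(\<lambda>x. ball x (d x)) fine p"
        by auto
      have finp: "finite p"
        using p by auto
      define E where "E = (\<lambda>(x::real, K). measure lborel K *\<^sub>R h x - (f (Sup K) - f (Inf K)))"
      define P where "P = {(x, K). (x, K) \<in> p \<and> x \<in> N}"
      have Pp: "P \<subseteq> p"
        by (auto simp: P_def)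
      \<comment> \<open>the increments of \<open>f\<close> telescope, so that only the error of each tagged interval remains\<close>
      have total: "(\<Sum>(x, K)\<in>p. measure lborel K *\<^sub>R h x) - (f \<beta> - f \<alpha>) = sum E p"
        using additive_tagged_division_1[OF ab(2), of p f] p
        by (simp add: E_def sum_subtractf split_def)
      have mem: "\<exists>u v. K = {u..v} \<and> u \<le> x \<and> x \<le> v \<and> u \<in> I01 \<and> v \<in> I01 \<and> K \<subseteq> ball x (d x)"
        if xK: "(x, K) \<in> p" for x K
      proof -
        obtain u v where "K = {u..v}"
          using tagged_division_ofD(4)[OF p xK] by auto
        moreover have "x \<in> K" "K \<subseteq> {\<alpha>..\<beta>}"
          using tagged_division_ofD(2,3)[OF p xK] by auto
        moreover have "K \<subseteq> ball x (d x)"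
          using fine xK by (auto simp: fine_def)
        ultimately show ?thesis
          using sub by (intro exI[of _ u] exI[of _ v]) auto
      qed
      have good: "norm (E z) \<le> e/2 * (case z of (x, K) \<Rightarrow> Sup K - Inf K)" if z: "z \<in> p - P" for z
      proof -
        obtain x K where zx: "z = (x, K)" "(x, K) \<in> p" "x \<notin> N"
          using z by (cases z) (auto simp: P_def)
        obtain u v where uv: "K = {u..v}" "u \<le> x" "x \<le> v" "u \<in> I01" "v \<in> I01" "K \<subseteq> ball x (d x)"
          using mem[OF zx(2)] by blast
        have x: "x \<in> I01 - N"
          using uv zx(3) by auto
        have "u \<in> K" "v \<in> K"
          using uv(1-3) by auto
        then have "u \<in> ball x (d x)" "v \<in> ball x (d x)"
          using uv(6) by blast+
        then have near: "norm (u - x) < d x" "norm (v - x) < d x"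
          by (auto simp: dist_real_def)
        have "E z = (f u - f x - (u - x) *\<^sub>R g x) - (f v - f x - (v - x) *\<^sub>R g x)"
          using uv zx by (simp add: E_def h_def algebra_simps)
        also have "norm \<dots> \<le> e/2 * norm (u - x) + e/2 * norm (v - x)"
          using d(3)[OF x uv(4) near(1)] d(3)[OF x uv(5) near(2)] norm_triangle_ineq4 by (meson add_mono order_trans)
        also have "\<dots> = e/2 * (v - u)"
          using uv(2,3) by (simp add: field_simps)
        finally show ?thesis
          using uv zx by simp
      qed
      have len_nonneg: "0 \<le> (case z of (x, K) \<Rightarrow> Sup K - Inf K)" if "z \<in> p" for z
        using mem that by (cases z) fastforce
      have "norm (sum E (p - P)) \<le> (\<Sum>z\<in>p - P. e/2 * (case z of (x, K) \<Rightarrow> Sup K - Inf K))"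
        by (rule sum_norm_le) (rule good)
      also have "\<dots> = e/2 * (\<Sum>z\<in>p - P. case z of (x, K) \<Rightarrow> Sup K - Inf K)"
        by (simp add: sum_distrib_left)
      also have "\<dots> \<le> e/2 * (\<Sum>z\<in>p. case z of (x, K) \<Rightarrow> Sup K - Inf K)"
        using \<open>e > 0\<close> len_nonneg finp by (intro mult_left_mono sum_mono2) auto
      also have "\<dots> = e/2 * (\<beta> - \<alpha>)"
        using additive_tagged_division_1[OF ab(2), of p "\<lambda>x. x"] p by simp
      also have "\<dots> \<le> e/2"
        using \<open>e > 0\<close> ab by (intro mult_left_le) auto
      finally have 1: "norm (sum E (p - P)) \<le> e/2" .
      have Ptag: "P tagged_division_of \<Union>(snd ` P)"
        using p Pp by (meson tagged_division_of_def tagged_partial_division_of_Union_self tagged_partial_division_subset)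
      then have Pdiv: "snd ` P division_of \<Union>(snd ` P)"
        by (rule division_of_tagged_division)
      have inP: "K \<subseteq> U \<and> K \<subseteq> I01 \<and> K \<noteq> {}" if "(x, K) \<in> P" for x K
      proof -
        have xK: "(x, K) \<in> p" "x \<in> N"
          using that by (auto simp: P_def)
        obtain u v where "K = {u..v}" "u \<le> x" "x \<le> v" "u \<in> I01" "v \<in> I01" "K \<subseteq> ball x (d x)"
          using mem[OF xK(1)] by blast
        then show ?thesis
          using d(2)[OF xK(2)] by auto
      qed
      then have PU: "\<Union>(snd ` P) \<subseteq> U" and PI: "\<Union>(snd ` P) \<subseteq> I01"
        by fastforce+
      have "(\<Sum>K\<in>snd ` P. Sup K - Inf K) = (\<Sum>K\<in>snd ` P. measure lebesgue K)"
      proof (rule sum.cong)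
        fix K assume "K \<in> snd ` P"
        note K = division_I01_member(3,4)[OF Pdiv PI this]
        have "measure lebesgue {Inf K..Sup K} = Sup K - Inf K"
          using K(1) by simp
        then show "Sup K - Inf K = measure lebesgue K"
          using K(2) by metis
      qed simp
      also have "\<dots> = measure lebesgue (\<Union>(snd ` P))"
        by (rule content_division[OF Pdiv])
      also have "\<dots> \<le> measure lebesgue U"
        using PU Um(1) lmeasurable_division[OF Pdiv] by (intro measure_mono_fmeasurable) auto
      also have "\<dots> < \<delta>"
        by (rule Um(2))
      finally have short: "(\<Sum>K\<in>snd ` P. Sup K - Inf K) < \<delta>" .
      \<comment> \<open>A sum over tagged intervals becomes one over the set of intervals: an interval can carry two tags
          only if it is degenerate, and then its term vanishes. The empty set gets the value 0, as this
          conversion asks for it and \<open>Sup {}\<close> has no useful value.\<close>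
      define var where "var K = (if K = {} then 0 else \<bar>f (Sup K) - f (Inf K)\<bar>)" for K
      have "norm (sum E P) \<le> (\<Sum>z\<in>P. \<bar>f (Sup (snd z)) - f (Inf (snd z))\<bar>)"
        by (rule sum_norm_le) (auto simp: E_def P_def h_def)
      also have "\<dots> = (\<Sum>(x, K)\<in>P. var K)"
        using inP by (intro sum.cong) (auto simp: var_def)
      also have "\<dots> = (\<Sum>K\<in>snd ` P. var K)"
        by (rule sum.over_tagged_division_lemma[OF Ptag]) (auto simp: var_def)
      also have "\<dots> = (\<Sum>K\<in>snd ` P. \<bar>f (Sup K) - f (Inf K)\<bar>)"
        using division_ofD(3)[OF Pdiv] by (intro sum.cong) (auto simp: var_def)
      also have "\<dots> < e/2"
        using Pdiv PI short by (intro \<delta>(2)) auto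
      finally have 2: "norm (sum E P) < e/2" .
      have "sum E p = sum E (p - P) + sum E P"
        using sum.subset_diff[OF Pp finp] by simp
      then show "norm ((\<Sum>(x, k)\<in>p. measure lborel k *\<^sub>R h x) - (f \<beta> - f \<alpha>)) < e"
        unfolding total using 1 2 norm_triangle_ineq[of "sum E (p - P)" "sum E P"] by simp
    qed
  qed
  then have "(h has_integral (f \<beta> - f \<alpha>)) {\<alpha>..\<beta>}"
    by simp
  then show ?thesis
    by (rule has_integral_spike[OF N, rotated]) (auto simp: h_def)
qed

section \<open>Solutions of the differential equation\<close>

text \<open>The form in which \<open>AC_has_integral\<close> can use a differential equation.\<close>

lemma solves_iff_negligible:
  "solves a lam \<sigma> u \<longleftrightarrow> (\<exists>N. negligible N \<and>
     (\<forall>t\<in>I01 - N. (D u has_vector_derivative \<sigma> t - (a t + lam) * u t) (at t within I01)))"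
    (is "_ \<longleftrightarrow> ?R")
proof -
  have eq: "D u differentiable (at t within I01) \<and> L a lam u t = \<sigma> t \<longleftrightarrow>
      (D u has_vector_derivative \<sigma> t - (a t + lam) * u t) (at t within I01)" if "t \<in> I01" for t
  proof
    assume *: "D u differentiable (at t within I01) \<and> L a lam u t = \<sigma> t"
    then have "D (D u) t = \<sigma> t - (a t + lam) * u t"
      by (simp add: L_def)
    then show "(D u has_vector_derivative \<sigma> t - (a t + lam) * u t) (at t within I01)"
      using D_has_derivative[of "D u" t] * by simp
  next
    assume *: "(D u has_vector_derivative \<sigma> t - (a t + lam) * u t) (at t within I01)"
    then show "D u differentiable (at t within I01) \<and> L a lam u t = \<sigma> t"
      using D_eqI[OF * that] differentiableI_vector by (simp add: L_def) blast
  qed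
  have "solves a lam \<sigma> u \<longleftrightarrow> (AE t in lebesgue. t \<in> I01 \<longrightarrow>
      (D u has_vector_derivative \<sigma> t - (a t + lam) * u t) (at t within I01))"
    unfolding solves_def by (subst AE_restrict_space_iff) (auto simp: eq cong: imp_cong)
  also have "\<dots> \<longleftrightarrow> ?R"
    unfolding eventually_ae_filter negligible_iff_null_sets Bex_def
    by (intro arg_cong[where f = Ex] ext) auto
  finally show ?thesis .
qed

lemma W21_linear_combination:
  assumes u: "u \<in> W21" and v: "v \<in> W21"
  shows "(\<lambda>t. c * u t + d * v t) \<in> W21"
    and "\<And>t. t \<in> I01 \<Longrightarrow> D (\<lambda>t. c * u t + d * v t) t = c * D u t + d * D v t"
proof -
  let ?w = "\<lambda>t. c * u t + d * v t"
  have der: "(?w has_vector_derivative c * D u t + d * D v t) (at t within I01)" if "t \<in> I01" for t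
    using W21_has_derivative[OF u that] W21_has_derivative[OF v that]
    by (auto intro!: derivative_eq_intros simp: has_real_derivative_iff_has_vector_derivative[symmetric])
  show eq: "D ?w t = c * D u t + d * D v t" if "t \<in> I01" for t
    using D_eqI[OF der[OF that] that] .
  have "D ?w \<in> AC"
    using AC_linear_combination[OF W21_imp_AC(2)[OF u] W21_imp_AC(2)[OF v] eq] .
  moreover have "continuous_on I01 ?w"
    using u v by (auto simp: W21_def intro!: continuous_intros)
  moreover have "?w differentiable_on I01"
    unfolding differentiable_on_def by (blast intro: differentiableI_vector der)
  ultimately show "?w \<in> W21"
    by (simp add: W21_def)
qed

lemma solves_linear_combination:
  assumes u: "u \<in> W21" "solves a lam \<sigma> u" and v: "v \<in> W21" "solves a lam \<tau> v"
  shows "solves a lam (\<lambda>t. c * \<sigma> t + d * \<tau> t) (\<lambda>t. c * u t + d * v t)"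
proof -
  let ?w = "\<lambda>t. c * u t + d * v t"
  obtain N where N: "negligible N"
    "\<And>t. t \<in> I01 - N \<Longrightarrow> (D u has_vector_derivative \<sigma> t - (a t + lam) * u t) (at t within I01)"
    using u(2) unfolding solves_iff_negligible by blast
  obtain M where M: "negligible M"
    "\<And>t. t \<in> I01 - M \<Longrightarrow> (D v has_vector_derivative \<tau> t - (a t + lam) * v t) (at t within I01)"
    using v(2) unfolding solves_iff_negligible by blast
  show ?thesis
    unfolding solves_iff_negligible
  proof (intro exI[of _ "N \<union> M"] conjI ballI)
    show "negligible (N \<union> M)"
      using N(1) M(1) by (rule negligible_Un)
    fix t assume t: "t \<in> I01 - (N \<union> M)"
    have "((\<lambda>t. c * D u t + d * D v t) has_vector_derivative
        c * (\<sigma> t - (a t + lam) * u t) + d * (\<tau> t - (a t + lam) * v t)) (at t within I01)"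
      using N(2)[of t] M(2)[of t] t
      by (auto intro!: derivative_eq_intros simp: has_real_derivative_iff_has_vector_derivative[symmetric])
    then have "(D ?w has_vector_derivative
        c * (\<sigma> t - (a t + lam) * u t) + d * (\<tau> t - (a t + lam) * v t)) (at t within I01)"
      by (rule has_vector_derivative_transform[rotated 2])
         (use t W21_linear_combination(2)[OF u(1) v(1)] in auto)
    then show "(D ?w has_vector_derivative c * \<sigma> t + d * \<tau> t - (a t + lam) * ?w t) (at t within I01)"
      by (simp add: algebra_simps)
  qed
qed

text \<open>The derivative of \<open>u' v - u v'\<close> is \<open>u'' v - u v''\<close> almost everywhere, and the terms that
  contain the coefficient \<open>a + lam\<close> cancel. For \<open>\<sigma> = 0\<close> this says that the Wronskian
  of two homogeneous solutions is constant.\<close>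

lemma Lagrange_identity:
  assumes u: "u \<in> W21" "solves a lam \<sigma> u" and v: "v \<in> W21" "solves a lam (\<lambda>_. 0) v"
    and ab: "0 \<le> \<alpha>" "\<alpha> \<le> \<beta>" "\<beta> \<le> 1"
  shows "((\<lambda>s. \<sigma> s * v s) has_integral
           ((D u \<beta> * v \<beta> - u \<beta> * D v \<beta>) - (D u \<alpha> * v \<alpha> - u \<alpha> * D v \<alpha>))) {\<alpha>..\<beta>}"
proof -
  let ?W = "\<lambda>t. D u t * v t - u t * D v t"
  obtain N where N: "negligible N"
    "\<And>t. t \<in> I01 - N \<Longrightarrow> (D u has_vector_derivative \<sigma> t - (a t + lam) * u t) (at t within I01)"
    using u(2) unfolding solves_iff_negligible by blast
  obtain M where M: "negligible M"
    "\<And>t. t \<in> I01 - M \<Longrightarrow> (D v has_vector_derivative 0 - (a t + lam) * v t) (at t within I01)"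
    using v(2) unfolding solves_iff_negligible by blast
  show ?thesis
  proof (rule AC_has_integral[of ?W "N \<union> M" "\<lambda>s. \<sigma> s * v s", OF _ _ _ ab])
    show "?W \<in> AC"
      using AC_mult[OF W21_imp_AC(2)[OF u(1)] W21_imp_AC(1)[OF v(1)]]
        AC_mult[OF W21_imp_AC(1)[OF u(1)] W21_imp_AC(2)[OF v(1)]]
      by (rule AC_linear_combination[where c = 1 and d = "-1"]) simp
    show "negligible (N \<union> M)"
      using N(1) M(1) by (rule negligible_Un)
    fix t assume t: "t \<in> I01 - (N \<union> M)"
    have "(?W has_vector_derivative
        ((\<sigma> t - (a t + lam) * u t) * v t + D v t * D u t)
          - (D u t * D v t + (0 - (a t + lam) * v t) * u t)) (at t within I01)"
      using N(2)[of t] M(2)[of t] W21_has_derivative[OF u(1), of t] W21_has_derivative[OF v(1), of t] t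
      unfolding has_real_derivative_iff_has_vector_derivative[symmetric]
      by (intro DERIV_diff DERIV_mult) auto
    then show "(?W has_vector_derivative \<sigma> t * v t) (at t within I01)"
      by (simp add: algebra_simps)
  qed
qed

lemma W21_has_integral_D:
  assumes "u \<in> W21" and "0 \<le> \<alpha>" "\<alpha> \<le> \<beta>" "\<beta> \<le> 1"
  shows "(D u has_integral (u \<beta> - u \<alpha>)) {\<alpha>..\<beta>}"
  using assms W21_has_derivative
  by (intro AC_has_integral[of u "{}"] W21_imp_AC(1)) auto

text \<open>A contraction estimate in a weighted maximum norm, in the manner of Bielecki. Let \<open>M\<close> be
  the maximum of \<open>\<bar>r t\<bar> exp (- k t)\<close> and \<open>Q\<close> the integral of \<open>\<bar>a + lam\<bar>\<close>. Integrating the equation gives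
  \<open>\<bar>D r t\<bar> \<le> Q M exp (k t)\<close>; integrating once more gains the factor \<open>1 / k\<close>, whence
  \<open>M \<le> Q M / k\<close>. This forces \<open>M = 0\<close> as soon as \<open>k > Q\<close>.\<close>

lemma homogeneous_initial_value_unique:
  assumes a: "a \<in> L1" and r: "r \<in> W21" "solves a lam (\<lambda>_. 0) r"
    and init: "r 0 = 0" "D r 0 = 0" and t: "t \<in> I01"
  shows "r t = 0"
proof -
  define q where "q t = a t + lam" for t
  have "integrable (lebesgue_on I01) q"
    using a unfolding q_def L1_def by (intro Bochner_Integration.integrable_add) auto
  then have "integrable (lebesgue_on I01) (\<lambda>t. \<bar>q t\<bar>)"
    by (rule integrable_abs)
  then have absq: "(\<lambda>t. \<bar>q t\<bar>) integrable_on I01"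
    by (rule integrable_on_lebesgue_on) simp
  define Q where "Q = integral I01 (\<lambda>t. \<bar>q t\<bar>)"
  have "Q \<ge> 0"
    unfolding Q_def using absq by (intro integral_nonneg) auto
  define k where "k = Q + 1"
  have "k > 0" "k > Q"
    using \<open>Q \<ge> 0\<close> by (auto simp: k_def)
  have contr: "continuous_on I01 r"
    using r(1) by (simp add: W21_def)
  then have "continuous_on I01 (\<lambda>t. \<bar>r t\<bar> * exp (- k * t))"
    by (intro continuous_intros)
  then obtain t0 where t0: "t0 \<in> I01"
      "\<And>t. t \<in> I01 \<Longrightarrow> \<bar>r t\<bar> * exp (- k * t) \<le> \<bar>r t0\<bar> * exp (- k * t0)"
    using continuous_attains_sup[of I01 "\<lambda>t. \<bar>r t\<bar> * exp (- k * t)"] by auto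
  define M where "M = \<bar>r t0\<bar> * exp (- k * t0)"
  have "M \<ge> 0"
    by (simp add: M_def)
  have r_le: "\<bar>r t\<bar> \<le> M * exp (k * t)" if "t \<in> I01" for t
    using t0(2)[OF that] by (simp add: M_def exp_minus field_simps)
  obtain N where N: "negligible N"
    "\<And>t. t \<in> I01 - N \<Longrightarrow> (D r has_vector_derivative 0 - (a t + lam) * r t) (at t within I01)"
    using r(2) unfolding solves_iff_negligible by blast
  have Dr_le: "\<bar>D r t\<bar> \<le> Q * M * exp (k * t)" if "t \<in> I01" for t
  proof -
    have int: "((\<lambda>s. 0 - (a s + lam) * r s) has_integral (D r t - D r 0)) {0..t}"
      using that by (intro AC_has_integral[OF W21_imp_AC(2)[OF r(1)] N(1) N(2)]) auto
    have int_eq: "integral {0..t} (\<lambda>s. 0 - (a s + lam) * r s) = D r t"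
      using integral_unique[OF int] init(2) by simp
    have absqt: "(\<lambda>s. \<bar>q s\<bar>) integrable_on {0..t}"
      using absq that by (intro integrable_subinterval_real[OF absq]) auto
    have "norm (integral {0..t} (\<lambda>s. 0 - (a s + lam) * r s))
        \<le> integral {0..t} (\<lambda>s. \<bar>q s\<bar> * (M * exp (k * t)))"
    proof (rule Henstock_Kurzweil_Integration.integral_norm_bound_integral)
      show "(\<lambda>s. 0 - (a s + lam) * r s) integrable_on {0..t}"
        using int by blast
      show "(\<lambda>s. \<bar>q s\<bar> * (M * exp (k * t))) integrable_on {0..t}"
        using absqt by (rule integrable_on_mult_left)
      fix s assume s: "s \<in> {0..t}"
      have "\<bar>r s\<bar> \<le> M * exp (k * s)"
        using s that by (intro r_le) auto
      also have "\<dots> \<le> M * exp (k * t)"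
        using s \<open>M \<ge> 0\<close> \<open>k > 0\<close> by (intro mult_left_mono) auto
      finally have "\<bar>q s\<bar> * \<bar>r s\<bar> \<le> \<bar>q s\<bar> * (M * exp (k * t))"
        by (rule mult_left_mono) simp
      then show "norm (0 - (a s + lam) * r s) \<le> \<bar>q s\<bar> * (M * exp (k * t))"
        by (simp add: q_def abs_mult)
    qed
    also have "\<dots> = integral {0..t} (\<lambda>s. \<bar>q s\<bar>) * (M * exp (k * t))"
      by simp
    also have "\<dots> \<le> Q * (M * exp (k * t))"
      unfolding Q_def using that absq absqt \<open>M \<ge> 0\<close>
      by (intro mult_right_mono integral_subset_le) auto
    finally show ?thesis
      unfolding int_eq by (simp add: mult.assoc)
  qed
  have "(D r has_integral (r t0 - r 0)) {0..t0}"
    using t0(1) by (intro W21_has_integral_D[OF r(1)]) auto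
  moreover have exp_int: "((\<lambda>s. Q * M * exp (k * s)) has_integral
      (Q * M / k * exp (k * t0) - Q * M / k * exp (k * 0))) {0..t0}"
    using t0(1) \<open>k > 0\<close>
    by (intro fundamental_theorem_of_calculus)
       (auto intro!: derivative_eq_intros simp: has_real_derivative_iff_has_vector_derivative[symmetric])
  ultimately have "norm (r t0 - r 0) \<le> Q * M / k * exp (k * t0) - Q * M / k * exp (k * 0)"
    using Henstock_Kurzweil_Integration.integral_norm_bound_integral[of "D r" "{0..t0}" "\<lambda>s. Q * M * exp (k * s)"]
      Dr_le t0(1) by (auto simp: has_integral_iff)
  then have "\<bar>r t0\<bar> \<le> Q * M / k * exp (k * t0)"
    using init(1) \<open>Q \<ge> 0\<close> \<open>M \<ge> 0\<close> \<open>k > 0\<close> by (smt (verit) divide_nonneg_pos mult_nonneg_nonneg exp_ge_zero real_norm_def)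
  then have "\<bar>r t0\<bar> * exp (- k * t0) \<le> Q * M / k * exp (k * t0) * exp (- k * t0)"
    by (rule mult_right_mono) simp
  then have "M \<le> Q * M / k"
    by (simp add: M_def mult.assoc flip: exp_add)
  then have "M * (k - Q) \<le> 0"
    using \<open>k > 0\<close> by (simp add: field_simps)
  then have "M = 0"
    using \<open>M \<ge> 0\<close> \<open>k > Q\<close> by (simp add: mult_le_0_iff)
  then show ?thesis
    using r_le[OF t] by simp
qed

section \<open>Green's functions as kernels\<close>

text \<open>How an identity between integrals against kernels becomes pointwise: the difference of the
  two kernels is continuous, so it is itself an admissible right-hand side \<open>\<sigma>\<close>.\<close>

lemma square_integral_zero_imp_zero:
  fixes h :: "real \<Rightarrow> real"
  assumes "continuous_on I01 h" and "((\<lambda>s. h s * h s) has_integral 0) I01" and "s \<in> I01"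
  shows "h s = 0"
proof -
  have "h s * h s = 0"
    using assms by (intro has_integral_0_cbox_imp_0[of 0 1 "\<lambda>s. h s * h s" s]) (auto intro!: continuous_intros)
  then show ?thesis
    by simp
qed

lemma green_section_continuous:
  assumes "is_green a lam X G" and "t \<in> I01"
  shows "continuous_on I01 (G t)"
proof -
  have "continuous_on (Pair t ` I01) (\<lambda>(t, s). G t s)"
    using assms continuous_on_subset[of "I01 \<times> I01" _ "Pair t ` I01"]
    unfolding is_green_def by blast
  then have "continuous_on I01 ((\<lambda>(t, s). G t s) \<circ> Pair t)"
    by (intro continuous_on_compose continuous_on_Pair continuous_on_const continuous_on_id)
  then show ?thesis
    by (simp add: o_def)
qed

text \<open>For continuous data the Lebesgue integral in the definition of a Green's function is also a
  gauge integral, so it can be compared with the integrals from Lagrange's identity.\<close>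

lemma green_solution:
  assumes G: "is_green a lam X G" and \<sigma>: "continuous_on I01 \<sigma>"
  obtains u where "u \<in> X" and "solves a lam \<sigma> u"
    and "\<And>t. t \<in> I01 \<Longrightarrow> ((\<lambda>s. G t s * \<sigma> s) has_integral u t) I01"
proof
  let ?u = "\<lambda>t. LINT s|lebesgue_on I01. G t s * \<sigma> s"
  have "\<sigma> \<in> L1"
    using continuous_imp_integrable_real[OF \<sigma>] by (simp add: L1_def)
  then show "?u \<in> X" "solves a lam \<sigma> ?u"
    using G by (auto simp: is_green_def)
  show "((\<lambda>s. G t s * \<sigma> s) has_integral ?u t) I01" if "t \<in> I01" for t
  proof (rule has_integral_integral_lebesgue_on)
    show "integrable (lebesgue_on I01) (\<lambda>s. G t s * \<sigma> s)"
      using green_section_continuous[OF G that] \<sigma>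
      by (intro continuous_imp_integrable_real continuous_intros)
  qed simp
qed

text \<open>The classical kernel, with \<open>D r2 0\<close> as the value of the Wronskian of \<open>r1\<close> and \<open>r2\<close>.
  Pairing a solution \<open>u\<close> in \<open>X_D\<close> with \<open>r2\<close> on \<open>[0, t]\<close> and with \<open>r1\<close> on \<open>[t, 1]\<close>
  makes the boundary terms at 0 and 1 vanish; in the combination with weights \<open>r1 t\<close> and \<open>r2 t\<close> the
  terms with \<open>D u t\<close> cancel too, and \<open>u t\<close> remains with the Wronskian as its factor. Writing the
  two branches with \<open>max\<close> and \<open>min\<close> makes the continuity in \<open>s\<close> evident.\<close>

lemma Dirichlet_green_kernel:
  assumes G: "is_green a lam X_D G" and r1: "is_r1 a lam r1" and r2: "is_r2 a lam r2"
    and t: "t \<in> I01" and s: "s \<in> I01"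
  shows "D r2 0 * G t s = - (r1 (max t s) * r2 (min t s))"
proof -
  define K where "K s = r1 (max t s) * r2 (min t s)" for s
  \<comment> \<open>the difference of both sides of the claim, used as the datum of the Dirichlet problem\<close>
  define \<sigma> where "\<sigma> s = D r2 0 * G t s + K s" for s
  have R1: "r1 \<in> W21" "solves a lam (\<lambda>_. 0) r1" "r1 0 = 1" "r1 1 = 0"
    using r1 by (auto simp: is_r1_def)
  have R2: "r2 \<in> W21" "solves a lam (\<lambda>_. 0) r2" "r2 0 = 0" "r2 1 = 1"
    using r2 by (auto simp: is_r2_def)
  have cont: "continuous_on I01 r1" "continuous_on I01 r2"
    using R1 R2 by (auto simp: W21_def)
  have "continuous_on I01 (\<lambda>s. r1 (max t s))"
    by (rule continuous_on_compose2[OF cont(1), of I01 "max t"]) (use t in \<open>auto intro!: continuous_intros\<close>)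
  moreover have "continuous_on I01 (\<lambda>s. r2 (min t s))"
    by (rule continuous_on_compose2[OF cont(2), of I01 "min t"]) (use t in \<open>auto intro!: continuous_intros\<close>)
  ultimately have \<sigma>: "continuous_on I01 \<sigma>"
    unfolding \<sigma>_def K_def using green_section_continuous[OF G t] by (intro continuous_intros)
  obtain u where u: "u \<in> X_D" "solves a lam \<sigma> u"
      "\<And>t. t \<in> I01 \<Longrightarrow> ((\<lambda>s. G t s * \<sigma> s) has_integral u t) I01"
    using green_solution[OF G \<sigma>] by blast
  have U: "u \<in> W21" "u 0 = 0" "u 1 = 0"
    using u(1) by (auto simp: X_D_def)
  have "((\<lambda>s. 0 * r1 s) has_integral
      (D r2 t * r1 t - r2 t * D r1 t) - (D r2 0 * r1 0 - r2 0 * D r1 0)) {0..t}"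
    using t by (intro Lagrange_identity[OF R2(1,2) R1(1,2)]) auto
  then have W: "D r2 t * r1 t - r2 t * D r1 t = D r2 0"
    using R1(3) R2(3) by simp
  have "((\<lambda>s. r1 t * (\<sigma> s * r2 s)) has_integral
      r1 t * ((D u t * r2 t - u t * D r2 t) - (D u 0 * r2 0 - u 0 * D r2 0))) {0..t}"
    using t by (intro has_integral_mult_right Lagrange_identity[OF U(1) u(2) R2(1,2)]) auto
  moreover have "r1 t * (\<sigma> s * r2 s) = K s * \<sigma> s" if "s \<in> {0..t}" for s
    using that by (simp add: K_def max_absorb1 min_absorb2)
  ultimately have left: "((\<lambda>s. K s * \<sigma> s) has_integral
      r1 t * ((D u t * r2 t - u t * D r2 t) - (D u 0 * r2 0 - u 0 * D r2 0))) {0..t}"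
    by (rule has_integral_eq[rotated])
  have "((\<lambda>s. r2 t * (\<sigma> s * r1 s)) has_integral
      r2 t * ((D u 1 * r1 1 - u 1 * D r1 1) - (D u t * r1 t - u t * D r1 t))) {t..1}"
    using t by (intro has_integral_mult_right Lagrange_identity[OF U(1) u(2) R1(1,2)]) auto
  moreover have "r2 t * (\<sigma> s * r1 s) = K s * \<sigma> s" if "s \<in> {t..1}" for s
    using that by (simp add: K_def max_absorb2 min_absorb1)
  ultimately have right: "((\<lambda>s. K s * \<sigma> s) has_integral
      r2 t * ((D u 1 * r1 1 - u 1 * D r1 1) - (D u t * r1 t - u t * D r1 t))) {t..1}"
    by (rule has_integral_eq[rotated])
  have "r1 t * ((D u t * r2 t - u t * D r2 t) - (D u 0 * r2 0 - u 0 * D r2 0)) +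
        r2 t * ((D u 1 * r1 1 - u 1 * D r1 1) - (D u t * r1 t - u t * D r1 t))
      = - (u t * (D r2 t * r1 t - r2 t * D r1 t))"
    unfolding R1(4) R2(3) U(2,3) by (simp add: algebra_simps)
  also have "\<dots> = - (u t * D r2 0)"
    unfolding W ..
  finally have K: "((\<lambda>s. K s * \<sigma> s) has_integral - (u t * D r2 0)) I01"
    using has_integral_combine[OF _ _ left right] t by (simp only: atLeastAtMost_iff)
  have "((\<lambda>s. D r2 0 * (G t s * \<sigma> s) + K s * \<sigma> s) has_integral D r2 0 * u t + - (u t * D r2 0)) I01"
    by (intro has_integral_add has_integral_mult_right u(3)[OF t] K)
  moreover have "D r2 0 * (G t s * \<sigma> s) + K s * \<sigma> s = \<sigma> s * \<sigma> s" for s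
    unfolding \<sigma>_def[of s] by (simp only: distrib_right mult.assoc)
  ultimately have "((\<lambda>s. \<sigma> s * \<sigma> s) has_integral 0) I01"
    by simp
  then have "\<sigma> s = 0"
    using square_integral_zero_imp_zero[OF \<sigma> _ s] by blast
  then show ?thesis
    by (simp add: \<sigma>_def K_def)
qed

section \<open>Boundary derivatives of the Dirichlet kernel\<close>

text \<open>A continuous function that gives the derivative on the open interval also gives its
  extension to the endpoints.\<close>

lemma edge_ds_eqI:
  assumes der: "\<And>t. t \<in> {0<..<1} \<Longrightarrow> (G t has_vector_derivative r t) (at c within I01)"
    and c: "c \<in> I01" and r: "continuous_on I01 r"
  shows "edge_ds_exists G c" and "\<And>t. t \<in> I01 \<Longrightarrow> edge_ds G t c = r t"
proof -
  have D: "D (G t) c = r t" if "t \<in> {0<..<1}" for t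
    using D_eqI[OF der[OF that] c] .
  have lim: "((\<lambda>\<tau>. D (G \<tau>) c) \<longlongrightarrow> r t) (at t within {0<..<1})" if "t \<in> I01" for t
  proof -
    have "(r \<longlongrightarrow> r t) (at t within I01)"
      using r that by (simp add: continuous_on_def)
    then have "(r \<longlongrightarrow> r t) (at t within {0<..<1})"
      by (rule tendsto_within_subset) auto
    moreover have "\<forall>\<^sub>F \<tau> in at t within {0<..<1}. r \<tau> = D (G \<tau>) c"
      by (simp add: eventually_at_filter D)
    ultimately show ?thesis
      by (rule Lim_transform_eventually)
  qed
  show "edge_ds_exists G c"
    unfolding edge_ds_exists_def
  proof (intro conjI ballI)
    show "G t differentiable (at c within I01)" if "t \<in> {0<..<1}" for t
      using der[OF that] by (rule differentiableI_vector)
    show "\<exists>l. ((\<lambda>\<tau>. D (G \<tau>) c) \<longlongrightarrow> l) (at t within {0<..<1})" if "t \<in> {0, 1}" for t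
      using lim[of t] that by auto
  qed
  show "edge_ds G t c = r t" if "t \<in> I01" for t
  proof (cases "t \<in> {0<..<1}")
    case True
    then show ?thesis
      by (simp add: edge_ds_def D)
  next
    case False
    then have "t = 0 \<or> t = 1"
      using that by auto
    then have "at t within {0<..<1} \<noteq> bot"
      by (auto simp: trivial_limit_within islimpt_greaterThanLessThan1 islimpt_greaterThanLessThan2)
    then have "Lim (at t within {0<..<1}) (\<lambda>\<tau>. D (G \<tau>) c) = r t"
      by (rule tendsto_Lim[OF _ lim[OF that]])
    then show ?thesis
      unfolding edge_ds_def if_not_P[OF False] .
  qed
qed

text \<open>For \<open>t\<close> inside the interval, \<open>G t s\<close> is a multiple of \<open>r2 s\<close> near \<open>s = 0\<close> and of \<open>r1 s\<close>
  near \<open>s = 1\<close>. The Wronskian \<open>w\<close> equals \<open>D r2 0\<close> when evaluated at 0 and \<open>- D r1 1\<close> when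
  evaluated at 1, so it cancels in both derivatives. It does not vanish, since otherwise \<open>r2\<close>
  would have zero initial data and could not take the value 1.\<close>

lemma Dirichlet_green_edge_derivatives:
  assumes a: "a \<in> L1"
    and G: "is_green a lam X_D G" and r1: "is_r1 a lam r1" and r2: "is_r2 a lam r2"
    and t: "t \<in> {0<..<1}"
  shows "(G t has_vector_derivative - r1 t) (at 0 within I01)"
    and "(G t has_vector_derivative r2 t) (at 1 within I01)"
proof -
  have R1: "r1 \<in> W21" "solves a lam (\<lambda>_. 0) r1" "r1 0 = 1" "r1 1 = 0"
    using r1 by (auto simp: is_r1_def)
  have R2: "r2 \<in> W21" "solves a lam (\<lambda>_. 0) r2" "r2 0 = 0" "r2 1 = 1"
    using r2 by (auto simp: is_r2_def)
  define w where "w = D r2 0"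
  have "w \<noteq> 0"
    using homogeneous_initial_value_unique[OF a R2(1,2,3), of 1] R2(4) by (auto simp: w_def)
  have "((\<lambda>s. 0 * r1 s) has_integral
      (D r2 1 * r1 1 - r2 1 * D r1 1) - (D r2 0 * r1 0 - r2 0 * D r1 0)) {0..1}"
    by (intro Lagrange_identity[OF R2(1,2) R1(1,2)]) auto
  then have w: "w = - D r1 1"
    using R1(3,4) R2(3,4) by (simp add: w_def)
  have kernel: "G t s = - (r1 (max t s) * r2 (min t s)) / w" if "s \<in> I01" for s
    using Dirichlet_green_kernel[OF G r1 r2 _ that, of t] t \<open>w \<noteq> 0\<close> by (simp add: w_def field_simps)
  have "((\<lambda>s. - (r1 t / w) * r2 s) has_vector_derivative - (r1 t / w) * D r2 0) (at 0 within I01)"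
    by (intro has_vector_derivative_mult_right W21_has_derivative[OF R2(1)]) simp
  then have "((\<lambda>s. - (r1 t / w) * r2 s) has_vector_derivative - r1 t) (at 0 within I01)"
    using \<open>w \<noteq> 0\<close> by (simp add: w_def)
  then show "(G t has_vector_derivative - r1 t) (at 0 within I01)"
    by (rule has_vector_derivative_transform_within[where d = t])
       (use t kernel in \<open>auto simp: dist_real_def\<close>)
  have "((\<lambda>s. - (r2 t / w) * r1 s) has_vector_derivative - (r2 t / w) * D r1 1) (at 1 within I01)"
    by (intro has_vector_derivative_mult_right W21_has_derivative[OF R1(1)]) simp
  then have "((\<lambda>s. - (r2 t / w) * r1 s) has_vector_derivative r2 t) (at 1 within I01)"
    using \<open>w \<noteq> 0\<close> by (simp add: w)
  then show "(G t has_vector_derivative r2 t) (at 1 within I01)"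
    by (rule has_vector_derivative_transform_within[where d = "1 - t"])
       (use t kernel in \<open>auto simp: dist_real_def\<close>)
qed

section \<open>Comparison of the Neumann and Dirichlet kernels\<close>

text \<open>The Neumann solution minus the Dirichlet solution of the same equation is homogeneous, so
  nonresonance identifies it with the combination of \<open>r1\<close> and \<open>r2\<close> that has the same
  boundary values.\<close>

lemma green_Neumann_minus_Dirichlet:
  assumes nr: "nonresonant a lam X_D"
    and GD: "is_green a lam X_D GD" and GN: "is_green a lam X_N GN"
    and r1: "is_r1 a lam r1" and r2: "is_r2 a lam r2"
    and t: "t \<in> I01" and s: "s \<in> I01"
  shows "GN t s = GD t s + r1 t * GN 0 s + r2 t * GN 1 s"
proof -
  \<comment> \<open>again the difference of both sides is used as the datum\<close>
  define \<sigma> where "\<sigma> s = (GN t s - GD t s) - (r1 t * GN 0 s + r2 t * GN 1 s)" for s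
  have R1: "r1 \<in> W21" "solves a lam (\<lambda>_. 0) r1" "r1 0 = 1" "r1 1 = 0"
    using r1 by (auto simp: is_r1_def)
  have R2: "r2 \<in> W21" "solves a lam (\<lambda>_. 0) r2" "r2 0 = 0" "r2 1 = 1"
    using r2 by (auto simp: is_r2_def)
  have \<sigma>: "continuous_on I01 \<sigma>"
    unfolding \<sigma>_def using t green_section_continuous[OF GD] green_section_continuous[OF GN]
    by (intro continuous_intros) auto
  obtain u where u: "u \<in> X_N" "solves a lam \<sigma> u"
      "\<And>t. t \<in> I01 \<Longrightarrow> ((\<lambda>s. GN t s * \<sigma> s) has_integral u t) I01"
    using green_solution[OF GN \<sigma>] by blast
  obtain v where v: "v \<in> X_D" "solves a lam \<sigma> v"
      "\<And>t. t \<in> I01 \<Longrightarrow> ((\<lambda>s. GD t s * \<sigma> s) has_integral v t) I01"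
    using green_solution[OF GD \<sigma>] by blast
  have W: "u \<in> W21" "v \<in> W21"
    using u(1) v(1) by (auto simp: X_N_def X_D_def)
  define x where "x = (\<lambda>t. 1 * u t + (- 1) * v t)"
  define y where "y = (\<lambda>t. u 0 * r1 t + u 1 * r2 t)"
  define z where "z = (\<lambda>t. 1 * x t + (- 1) * y t)"
  have x: "x \<in> W21" "solves a lam (\<lambda>t. 1 * \<sigma> t + (- 1) * \<sigma> t) x"
    unfolding x_def by (intro W21_linear_combination(1) solves_linear_combination W u(2) v(2))+
  have y: "y \<in> W21" "solves a lam (\<lambda>t. u 0 * 0 + u 1 * 0) y"
    unfolding y_def by (intro W21_linear_combination(1) solves_linear_combination R1(1,2) R2(1,2))+
  have "z \<in> W21"
    unfolding z_def by (intro W21_linear_combination x y)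
  moreover have "solves a lam (\<lambda>_. 0) z"
    using solves_linear_combination[OF x y, of 1 "- 1"] by (simp add: z_def)
  moreover have "z 0 = 0" "z 1 = 0"
    using v(1) R1 R2 by (auto simp: z_def x_def y_def X_D_def)
  ultimately have "z t = 0"
    using nr t by (auto simp: nonresonant_def X_D_def)
  moreover have "((\<lambda>s. (GN t s * \<sigma> s - GD t s * \<sigma> s) - (r1 t * (GN 0 s * \<sigma> s) + r2 t * (GN 1 s * \<sigma> s)))
      has_integral (u t - v t) - (r1 t * u 0 + r2 t * u 1)) I01"
    using t by (intro has_integral_diff has_integral_add has_integral_mult_right u(3) v(3)) auto
  ultimately have "((\<lambda>s. \<sigma> s * \<sigma> s) has_integral 0) I01"
    by (simp add: \<sigma>_def z_def x_def y_def algebra_simps)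
  then have "\<sigma> s = 0"
    using square_integral_zero_imp_zero[OF \<sigma> _ s] by blast
  then show ?thesis
    by (simp add: \<sigma>_def)
qed

theorem theorem3p12:
  fixes a :: "real \<Rightarrow> real" and lam :: real
    and G\<^sub>D G\<^sub>N :: "real \<Rightarrow> real \<Rightarrow> real" and r\<^sub>1 r\<^sub>2 :: "real \<Rightarrow> real"
  assumes "a \<in> L1"
    and "nonresonant a lam X_D" and "nonresonant a lam X_N"
    and "is_green a lam X_D G\<^sub>D" and "is_green a lam X_N G\<^sub>N"
    and "is_r1 a lam r\<^sub>1" and "is_r2 a lam r\<^sub>2"
  shows "edge_ds_exists G\<^sub>D 0 \<and> edge_ds_exists G\<^sub>D 1 \<and>
    (\<forall>t\<in>I01. \<forall>s\<in>I01.
       G\<^sub>N t s = G\<^sub>D t s + r\<^sub>1 t * G\<^sub>N 0 s + r\<^sub>2 t * G\<^sub>N 1 s \<and>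
       G\<^sub>N t s = G\<^sub>D t s - edge_ds G\<^sub>D t 0 * G\<^sub>N 0 s + edge_ds G\<^sub>D t 1 * G\<^sub>N 1 s)"
proof -
  have cont: "continuous_on I01 (\<lambda>t. - r\<^sub>1 t)" "continuous_on I01 r\<^sub>2"
    using assms(6,7) by (auto simp: is_r1_def is_r2_def W21_def intro: continuous_on_minus)
  note der = Dirichlet_green_edge_derivatives[OF assms(1,4,6,7)]
  have edge0: "edge_ds_exists G\<^sub>D 0" "\<And>t. t \<in> I01 \<Longrightarrow> edge_ds G\<^sub>D t 0 = - r\<^sub>1 t"
    using edge_ds_eqI[of G\<^sub>D "\<lambda>t. - r\<^sub>1 t" 0, OF der(1) _ cont(1)] by auto
  have edge1: "edge_ds_exists G\<^sub>D 1" "\<And>t. t \<in> I01 \<Longrightarrow> edge_ds G\<^sub>D t 1 = r\<^sub>2 t"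
    using edge_ds_eqI[of G\<^sub>D r\<^sub>2 1, OF der(2) _ cont(2)] by auto
  have identity: "G\<^sub>N t s = G\<^sub>D t s + r\<^sub>1 t * G\<^sub>N 0 s + r\<^sub>2 t * G\<^sub>N 1 s"
    if "t \<in> I01" "s \<in> I01" for t s
    using green_Neumann_minus_Dirichlet[OF assms(2,4,5,6,7) that] .
  show ?thesis
  proof (intro conjI ballI edge0(1) edge1(1))
    fix t s assume ts: "t \<in> I01" "s \<in> I01"
    show "G\<^sub>N t s = G\<^sub>D t s + r\<^sub>1 t * G\<^sub>N 0 s + r\<^sub>2 t * G\<^sub>N 1 s"
      by (rule identity[OF ts])
    then show "G\<^sub>N t s = G\<^sub>D t s - edge_ds G\<^sub>D t 0 * G\<^sub>N 0 s + edge_ds G\<^sub>D t 1 * G\<^sub>N 1 s"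
      unfolding edge0(2)[OF ts(1)] edge1(2)[OF ts(1)] by simp
  qed
qed

end
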